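(* For any integer $m\geq 1$, any function $\varphi:A\to\mathbb{C}$ on $A=\mathbb{Z}/m\mathbb{Z}$, any interval $I$ in $A$, and any subset $D\subset A$, we have $$|S(\varphi;I)|\leq 2\|\varphi\|_\infty^{1/3}\Bigl\{|D|^{1/3}|I|^{1/3}\|\varphi\|_2^{2/3}+|I|^{2/3}\max_{a\notin D}|\mathcal{C}(\varphi,a)|^{1/3}+\frac{2}{3}|I|^{2/3}\|\varphi\|_\infty^{2/3}\Bigr\}.$$
   Context: For a finite abelian group $A$, a function $\varphi:A\to\mathbb{C}$ and a subset $B\subset A$: $S(\varphi;B)=\sum_{x\in B}\varphi(x)$, $\|\varphi\|_\infty=\max_{x\in A}|\varphi(x)|$, $\|\varphi\|_2=\bigl(\sum_{x\in A}|\varphi(x)|^2\bigr)^{1/2}$, and for $a\in A$ the additive correlation is $\mathcal{C}(\varphi,a)=\sum_{x\in A}\varphi(x)\overline{\varphi(x+a)}$. An interval in $\mathbb{Z}/m\mathbb{Z}$ is a subset which is the reduction modulo $m$ of an interval of consecutive integers on which reduction modulo $m$ is injective. If $D=A$, the maximum over $a\notin D$ is interpreted as $0$. *)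

theory Defs
  imports "HOL-Analysis.Analysis" "HOL-Algebra.Elementary_Groups"
begin

text \<open>
  Finite abelian groups are written multiplicatively, as in HOL-Algebra; the group
  of integers modulo $m$ is the library's \<^const>\<open>integer_mod_group\<close>, whose carrier for
  $m \geq 1$ is the set of representatives $0, \ldots, m - 1$. Only the values of
  \<open>\<phi>\<close> on the carrier matter. The maxima below are maxima of finite sets, so the
  carrier is meant to be finite.
\<close>

definition norm_sup :: "('a, 'b) monoid_scheme \<Rightarrow> ('a \<Rightarrow> complex) \<Rightarrow> real" where
  "norm_sup A \<phi> = Max ((\<lambda>x. cmod (\<phi> x)) ` carrier A)"

definition norm_two :: "('a, 'b) monoid_scheme \<Rightarrow> ('a \<Rightarrow> complex) \<Rightarrow> real" where
  "norm_two A \<phi> = sqrt (\<Sum>x\<in>carrier A. (cmod (\<phi> x))\<^sup>2)"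

definition add_corr :: "('a, 'b) monoid_scheme \<Rightarrow> ('a \<Rightarrow> complex) \<Rightarrow> 'a \<Rightarrow> complex" where
  "add_corr A \<phi> a = (\<Sum>x\<in>carrier A. \<phi> x * cnj (\<phi> (x \<otimes>\<^bsub>A\<^esub> a)))"

definition sum_over :: "('a \<Rightarrow> complex) \<Rightarrow> 'a set \<Rightarrow> complex" where
  "sum_over \<phi> B = (\<Sum>x\<in>B. \<phi> x)"

text \<open>The maximum over the complement of \<open>D\<close>, with value 0 if the complement is empty.\<close>

definition max_outside :: "('a, 'b) monoid_scheme \<Rightarrow> 'a set \<Rightarrow> ('a \<Rightarrow> real) \<Rightarrow> real" where
  "max_outside A D f = (if carrier A - D = {} then 0 else Max (f ` (carrier A - D)))"

text \<open>The integers \<open>a > b\<close> are allowed, so the empty set counts as an interval.\<close>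

definition is_interval_mod :: "nat \<Rightarrow> int set \<Rightarrow> bool" where
  "is_interval_mod m I \<longleftrightarrow>
     (\<exists>a b. inj_on (\<lambda>x. x mod int m) {a..b} \<and> I = (\<lambda>x. x mod int m) ` {a..b})"

end

(* Sliding sums: translating the interval by one changes its sum by at most 2 M, where M is the sup norm,
   so the translates by 0 <= x < m have sums of size at least |S| - 2 x M, and summing the squares
   of these lower bounds gives |S|^3 <= 6 M Q, where Q is the sum of the squared translates.
   Opening the square expresses Q through correlations: the at most |D| |I| pairs with difference
   in D contribute at most the squared 2-norm each, the others the maximum outside D. Since
   6 <= 8, a cube root already gives the claim without its third term. *)
theory Submission
  imports Defs
begin

text \<open>A discrete form of integrating 3 w^2 dw: \<open>s\<close> stays above a truncated line
  \<open>w\<close> that falls by at most 2 M per step, so each drop of \<open>w ^ 3\<close> is at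
  most 6 M w^2, and the drops telescope to \<open>s 0 ^ 3\<close>. The last assumption says that the
  line has reached 0 by step \<open>n\<close>, so no remainder is left.\<close>

lemma cube_le_sum_squares_of_slow_variation:
  fixes s :: "nat \<Rightarrow> real"
  assumes nonneg: "\<And>k. 0 \<le> s k" and step: "\<And>k. s k \<le> s (Suc k) + 2 * M"
    and "0 \<le> M" and "s 0 \<le> 2 * real n * M"
  shows "s 0 ^ 3 \<le> 6 * M * (\<Sum>k<n. (s k)\<^sup>2)"
proof -
  \<comment> \<open>Truncating at 0 keeps the lower bound nonnegative, so that
    \<open>w k \<le> s k\<close> survives squaring.\<close>
  define w where "w k = max 0 (s 0 - 2 * real k * M)" for k
  have w_le: "w k \<le> s k" for k
  proof (induction k)
    case 0
    then show ?case using nonneg[of 0] by (simp add: w_def)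
  next
    case (Suc k)
    then show ?case using step[of k] nonneg[of "Suc k"] by (auto simp: w_def algebra_simps)
  qed
  have tele: "w k ^ 3 - w (Suc k) ^ 3 \<le> 6 * M * (w k)\<^sup>2" for k
  \<comment> \<open>Near 0, where the truncation takes over at the next step, the whole cube
    \<open>w k ^ 3\<close> is already small enough. Above 2 M the next value still lies on the
    line.\<close>
  proof (cases "w k \<le> 2 * M")
    case True
    have "w k ^ 3 = w k * (w k)\<^sup>2" by (simp add: power3_eq_cube power2_eq_square)
    also have "\<dots> \<le> 6 * M * (w k)\<^sup>2"
      by (rule mult_right_mono) (use True \<open>0 \<le> M\<close> in auto)
    finally have "w k ^ 3 \<le> 6 * M * (w k)\<^sup>2" .
    moreover have "0 \<le> w (Suc k) ^ 3" by (simp add: w_def)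
    ultimately show ?thesis by linarith
  next
    case False
    then have eq: "w (Suc k) = w k - 2 * M"
      using \<open>0 \<le> M\<close> by (auto simp: w_def max_def algebra_simps split: if_splits)
    \<comment> \<open>Off the truncation the slack is an exact polynomial: 4 M^2 times 3 w - 2 M,
      which is nonnegative as w exceeds 2 M.\<close>
    have "6 * M * (w k)\<^sup>2 - (w k ^ 3 - w (Suc k) ^ 3) = 12 * M\<^sup>2 * w k - 8 * M ^ 3"
      unfolding eq by (simp add: algebra_simps power2_eq_square power3_eq_cube)
    also have "\<dots> = 4 * M\<^sup>2 * (3 * w k - 2 * M)"
      by (simp add: algebra_simps power2_eq_square power3_eq_cube)
    also have "\<dots> \<ge> 0" using False \<open>0 \<le> M\<close> by simp
    finally show ?thesis by simp
  qed
  have "s 0 ^ 3 = w 0 ^ 3 - w n ^ 3"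
    using assms nonneg[of 0] by (simp add: w_def)
  also have "\<dots> = (\<Sum>k<n. w k ^ 3 - w (Suc k) ^ 3)"
    by (rule sum_lessThan_telescope'[where f = "\<lambda>k. w k ^ 3", symmetric])
  also have "\<dots> \<le> (\<Sum>k<n. 6 * M * (w k)\<^sup>2)" by (intro sum_mono tele)
  also have "\<dots> \<le> (\<Sum>k<n. 6 * M * (s k)\<^sup>2)"
    using \<open>0 \<le> M\<close> w_le by (intro sum_mono mult_left_mono power_mono) (auto simp: w_def)
  finally show ?thesis by (simp add: sum_distrib_left)
qed

lemma sum_mod_translate:
  fixes m h :: int and g :: "int \<Rightarrow> 'b::comm_monoid_add"
  assumes "m > 0"
  shows "(\<Sum>x\<in>{0..<m}. g ((x + h) mod m)) = (\<Sum>x\<in>{0..<m}. g x)"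
  by (rule sum.reindex_bij_witness[where i = "\<lambda>y. (y - h) mod m" and j = "\<lambda>x. (x + h) mod m"])
    (use assms in \<open>auto simp: mod_simps\<close>)

text \<open>Substitute x + h for x. In this form the correlation at k - h appears when the square of
  a translated sum is multiplied out.\<close>

lemma add_corr_integer_mod_group:
  assumes "m > 0"
  shows "add_corr (integer_mod_group m) \<phi> ((k - h) mod int m) =
    (\<Sum>x\<in>{0..<int m}. \<phi> ((x + h) mod int m) * cnj (\<phi> ((x + k) mod int m)))"
proof -
  have "add_corr (integer_mod_group m) \<phi> ((k - h) mod int m) =
      (\<Sum>x\<in>{0..<int m}. \<phi> x * cnj (\<phi> ((x + (k - h)) mod int m)))"
    using assms by (simp add: add_corr_def carrier_integer_mod_group mult_integer_mod_group mod_simps)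
  also have "\<dots> = (\<Sum>x\<in>{0..<int m}. \<phi> ((x + h) mod int m) *
      cnj (\<phi> (((x + h) mod int m + (k - h)) mod int m)))"
    using assms by (subst sum_mod_translate[symmetric, where h = h]) auto
  finally show ?thesis by (simp add: mod_simps)
qed

text \<open>The arithmetic-geometric mean inequality splits each product into two halves, and
  translation invariance makes the two halves equal after summation. This is the trivial bound, used
  for the differences in \<open>D\<close>.\<close>

lemma cmod_add_corr_le_norm_two:
  assumes "m > 0"
  shows "cmod (add_corr (integer_mod_group m) \<phi> a) \<le> (norm_two (integer_mod_group m) \<phi>)\<^sup>2"
proof -
  let ?q = "\<lambda>x. (cmod (\<phi> x))\<^sup>2"
  have am_gm: "cmod (z * cnj w) \<le> ((cmod z)\<^sup>2 + (cmod w)\<^sup>2) / 2" for z w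
    using sum_squares_bound[of "cmod z" "cmod w"] by (simp add: norm_mult)
  have "cmod (add_corr (integer_mod_group m) \<phi> a) \<le>
      (\<Sum>x\<in>{0..<int m}. (?q x + ?q ((x + a) mod int m)) / 2)"
    using assms am_gm
    by (auto simp: add_corr_def carrier_integer_mod_group mult_integer_mod_group intro!: sum_norm_le)
  also have "\<dots> = ((\<Sum>x\<in>{0..<int m}. ?q x) + (\<Sum>x\<in>{0..<int m}. ?q ((x + a) mod int m))) / 2"
    by (simp flip: sum_divide_distrib add: sum.distrib)
  also have "\<dots> = (\<Sum>x\<in>{0..<int m}. ?q x)"
    using assms sum_mod_translate[of "int m" ?q a] by simp
  finally show ?thesis
    using assms by (simp add: norm_two_def carrier_integer_mod_group sum_nonneg)
qed

text \<open>Write |z|^2 as z times its conjugate, multiply out and sum over x first. The identity is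
  stated over the complex numbers because the single correlations need not be real.\<close>

lemma sum_cmod_square_eq_sum_add_corr:
  assumes "m > 0"
  shows "(\<Sum>x\<in>{0..<int m}. complex_of_real ((cmod (\<Sum>h\<in>J. \<phi> ((x + h) mod int m)))\<^sup>2)) =
    (\<Sum>h\<in>J. \<Sum>k\<in>J. add_corr (integer_mod_group m) \<phi> ((k - h) mod int m))"
proof -
  have "(\<Sum>x\<in>{0..<int m}. complex_of_real ((cmod (\<Sum>h\<in>J. \<phi> ((x + h) mod int m)))\<^sup>2)) =
      (\<Sum>x\<in>{0..<int m}. \<Sum>h\<in>J. \<Sum>k\<in>J. \<phi> ((x + h) mod int m) * cnj (\<phi> ((x + k) mod int m)))"
    unfolding complex_norm_square by (simp add: sum_product)
  also have "\<dots> = (\<Sum>h\<in>J. \<Sum>k\<in>J. \<Sum>x\<in>{0..<int m}.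
      \<phi> ((x + h) mod int m) * cnj (\<phi> ((x + k) mod int m)))"
    by (subst sum.swap, rule sum.cong, rule refl, rule sum.swap)
  finally show ?thesis by (simp add: add_corr_integer_mod_group[OF assms])
qed

text \<open>The pairs (h, k) are counted row by row: once h is fixed, each residue in
  \<open>D\<close> is the difference k - h for at most one k, so the trivial bound is paid at most
  |D| |J| times.\<close>

lemma sum_translates_square_le:
  fixes J D :: "int set"
  assumes "m > 0" and inj: "inj_on (\<lambda>x. x mod int m) J" and "finite J" and "finite D"
    and "0 \<le> C"
    and outside: "\<And>a. a \<in> {0..<int m} - D \<Longrightarrow> cmod (add_corr (integer_mod_group m) \<phi> a) \<le> C"
  shows "(\<Sum>x\<in>{0..<int m}. (cmod (\<Sum>h\<in>J. \<phi> ((x + h) mod int m)))\<^sup>2) \<le>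
    real (card D) * real (card J) * (norm_two (integer_mod_group m) \<phi>)\<^sup>2 + (real (card J))\<^sup>2 * C"
proof -
  let ?G = "integer_mod_group m"
  let ?N = "(norm_two ?G \<phi>)\<^sup>2"
  let ?c = "\<lambda>h k. add_corr ?G \<phi> ((k - h) mod int m)"
  let ?Q = "\<Sum>x\<in>{0..<int m}. (cmod (\<Sum>h\<in>J. \<phi> ((x + h) mod int m)))\<^sup>2"
  have row: "(\<Sum>k\<in>J. cmod (?c h k)) \<le> real (card D) * ?N + real (card J) * C" for h
  proof -
    let ?K = "{k \<in> J. (k - h) mod int m \<in> D}"
    \<comment> \<open>Subtracting h does not affect congruence, so injectivity of reduction on
      \<open>J\<close> carries over to the differences.\<close>
    have "inj_on (\<lambda>k. (k - h) mod int m) J"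
    proof (rule inj_onI)
      fix k l assume "k \<in> J" "l \<in> J" "(k - h) mod int m = (l - h) mod int m"
      then show "k = l"
        using inj by (metis diff_add_cancel inj_on_def mod_add_left_eq)
    qed
    then have "card ?K \<le> card D"
      by (intro card_inj_on_le[where f = "\<lambda>k. (k - h) mod int m"] \<open>finite D\<close>)
        (auto simp: inj_on_def)
    then have cardK: "real (card ?K) * ?N \<le> real (card D) * ?N"
      by (intro mult_right_mono) auto
    \<comment> \<open>Charging \<open>C\<close> to every k, also when the difference lies in
      \<open>D\<close>, costs nothing in sign and gives the clean total
      \<open>real (card J) * C\<close>.\<close>
    have "(\<Sum>k\<in>J. cmod (?c h k)) \<le> (\<Sum>k\<in>J. (if (k - h) mod int m \<in> D then ?N else 0) + C)"
    proof (rule sum_mono)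
      fix k
      show "cmod (?c h k) \<le> (if (k - h) mod int m \<in> D then ?N else 0) + C"
        using outside[of "(k - h) mod int m"] cmod_add_corr_le_norm_two[OF \<open>m > 0\<close>, of \<phi> "(k - h) mod int m"]
          \<open>m > 0\<close> \<open>0 \<le> C\<close> by auto
    qed
    also have "\<dots> = real (card ?K) * ?N + real (card J) * C"
      using \<open>finite J\<close> by (simp add: sum.distrib sum.If_cases Int_def)
    finally show ?thesis using cardK by simp
  qed
  \<comment> \<open>The real number \<open>?Q\<close> is nonnegative, hence equals its own modulus
    as a complex number; this lets the triangle inequality act on the complex double sum.\<close>
  have "?Q = cmod (complex_of_real ?Q)"
    by (simp only: norm_of_real) (simp add: sum_nonneg)
  also have "\<dots> = cmod (\<Sum>h\<in>J. \<Sum>k\<in>J. ?c h k)"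
    using sum_cmod_square_eq_sum_add_corr[OF \<open>m > 0\<close>, of \<phi> J] by (simp only: of_real_sum)
  also have "\<dots> \<le> (\<Sum>h\<in>J. \<Sum>k\<in>J. cmod (?c h k))"
    by (intro sum_norm_le) auto
  also have "\<dots> \<le> (\<Sum>h\<in>J. real (card D) * ?N + real (card J) * C)"
    by (intro sum_mono row)
  finally show ?thesis by (simp add: algebra_simps power2_eq_square)
qed

text \<open>The moduli of the translated sums form a slowly varying sequence: a shift by one drops
  the term at one end and gains a term at the other, each of modulus at most
  \<open>M\<close>.\<close>

lemma cube_sum_interval_le:
  assumes "m > 0" and inj: "inj_on (\<lambda>x. x mod int m) {a..b}"
    and bound: "\<And>x. x \<in> {0..<int m} \<Longrightarrow> cmod (\<phi> x) \<le> M"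
  shows "cmod (\<Sum>h\<in>{a..b}. \<phi> (h mod int m)) ^ 3 \<le>
    6 * M * (\<Sum>x\<in>{0..<int m}. (cmod (\<Sum>h\<in>{a..b}. \<phi> ((x + h) mod int m)))\<^sup>2)"
proof -
  define T where "T x = (\<Sum>h\<in>{a..b}. \<phi> ((x + h) mod int m))" for x
  have bound': "cmod (\<phi> (x mod int m)) \<le> M" for x
    using bound \<open>m > 0\<close> by simp
  then have "0 \<le> M" using norm_ge_zero order_trans by blast
  have "cmod (T x) \<le> cmod (T (x + 1)) + 2 * M" for x
  proof (cases "a \<le> b")
    case True
    have "T (x + 1) = (\<Sum>h\<in>{a + 1..b + 1}. \<phi> ((x + h) mod int m))"
      unfolding T_def
      by (rule sum.reindex_bij_witness[where i = "\<lambda>h. h - 1" and j = "\<lambda>h. h + 1"])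
        (auto simp: algebra_simps)
    \<comment> \<open>The common block from a + 1 to b cancels, leaving only the two end terms. It
      may be empty, when a = b.\<close>
    moreover have "{a + 1..b + 1} = insert (b + 1) {a + 1..b}" "{a..b} = insert a {a + 1..b}"
      using True by auto
    ultimately have "T x = T (x + 1) + (\<phi> ((x + a) mod int m) - \<phi> ((x + (b + 1)) mod int m))"
      unfolding T_def by simp
    then have "cmod (T x) \<le> cmod (T (x + 1)) +
        cmod (\<phi> ((x + a) mod int m) - \<phi> ((x + (b + 1)) mod int m))"
      by (metis norm_triangle_ineq)
    also have "\<dots> \<le> cmod (T (x + 1)) + (cmod (\<phi> ((x + a) mod int m)) + cmod (\<phi> ((x + (b + 1)) mod int m)))"
      by (intro add_left_mono norm_triangle_ineq4)
    finally show ?thesis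
      using bound'[of "x + a"] bound'[of "x + (b + 1)"] by simp
  next
    case False
    then show ?thesis using \<open>0 \<le> M\<close> by (simp add: T_def)
  qed
  then have step: "cmod (T (int k)) \<le> cmod (T (int (Suc k))) + 2 * M" for k
    by (metis add.commute of_nat_Suc)
  \<comment> \<open>Injectivity of reduction limits the length to m. Hence |T 0| is at most m M, and
    m steps suffice for the descending line to reach 0.\<close>
  have "card {a..b} \<le> card {0..<int m}"
    using \<open>m > 0\<close> by (intro card_inj_on_le[OF inj]) auto
  have "cmod (T 0) \<le> real (card {a..b}) * M"
    unfolding T_def using bound' by (intro sum_norm_bound)
  also have "\<dots> \<le> (2 * real m) * M"
    using \<open>card {a..b} \<le> _\<close> \<open>0 \<le> M\<close> by (intro mult_right_mono) auto
  finally have "cmod (T (int 0)) ^ 3 \<le> 6 * M * (\<Sum>k<m. (cmod (T (int k)))\<^sup>2)"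
    by (intro cube_le_sum_squares_of_slow_variation)
      (use step \<open>0 \<le> M\<close> in simp_all)
  \<comment> \<open>The m steps run through each residue exactly once.\<close>
  also have "(\<Sum>k<m. (cmod (T (int k)))\<^sup>2) = (\<Sum>x\<in>{0..<int m}. (cmod (T x))\<^sup>2)"
    by (rule sum.reindex_bij_witness[where i = nat and j = int]) auto
  finally show ?thesis by (simp add: T_def)
qed

text \<open>Compare cubes: the mixed terms 3 p q (p + q) of (p + q)^3 are nonnegative.\<close>

lemma powr_one_third_add_le:
  fixes x y :: real
  assumes "0 \<le> x" "0 \<le> y"
  shows "(x + y) powr (1/3) \<le> x powr (1/3) + y powr (1/3)"
proof -
  have cube: "(z powr (1/3)) ^ 3 = z" if "0 \<le> z" for z :: real
    using that by (simp flip: powr_numeral add: powr_powr)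
  let ?p = "x powr (1/3)" and ?q = "y powr (1/3)"
  have "((x + y) powr (1/3)) ^ 3 = ?p ^ 3 + ?q ^ 3" using assms by (simp add: cube)
  also have "\<dots> \<le> ?p ^ 3 + ?q ^ 3 + 3 * ?p * ?q * (?p + ?q)" by simp
  also have "\<dots> = (?p + ?q) ^ 3" by (simp add: power3_eq_cube algebra_simps)
  finally show ?thesis by (rule power_le_imp_le_base[of _ 2, simplified]) simp
qed

lemma max_outside_ge:
  assumes "finite (carrier A)" "a \<in> carrier A - D"
  shows "f a \<le> max_outside A D f"
  using assms by (auto simp: max_outside_def intro!: Max_ge)

lemma max_outside_nonneg:
  assumes "finite (carrier A)" "\<And>a. 0 \<le> f a"
  shows "0 \<le> max_outside A D f"
proof (cases "carrier A - D = {}")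
  case False
  then obtain a where "a \<in> carrier A - D" by blast
  then show ?thesis using max_outside_ge[OF assms(1)] assms(2) order_trans by blast
qed (simp add: max_outside_def)

theorem theorem2p1:
  fixes m :: nat and \<phi> :: "int \<Rightarrow> complex" and I D :: "int set"
  defines "A \<equiv> integer_mod_group m"
  assumes "m \<ge> 1"
    and "is_interval_mod m I"
    and "D \<subseteq> carrier A"
  shows "cmod (sum_over \<phi> I) \<le>
    2 * norm_sup A \<phi> powr (1/3) *
      (real (card D) powr (1/3) * real (card I) powr (1/3) * norm_two A \<phi> powr (2/3)
       + real (card I) powr (2/3) * max_outside A D (\<lambda>a. cmod (add_corr A \<phi> a) powr (1/3))
       + 2/3 * real (card I) powr (2/3) * norm_sup A \<phi> powr (2/3))"
proof -
  have "m > 0" using \<open>m \<ge> 1\<close> by simp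
  have carrier: "carrier A = {0..<int m}"
    using \<open>m > 0\<close> by (simp add: A_def carrier_integer_mod_group)
  obtain a b where inj: "inj_on (\<lambda>x. x mod int m) {a..b}"
    and I: "I = (\<lambda>x. x mod int m) ` {a..b}"
    using \<open>is_interval_mod m I\<close> by (auto simp: is_interval_mod_def)
  define M where "M = norm_sup A \<phi>"
  define N where "N = norm_two A \<phi>"
  define c where "c = max_outside A D (\<lambda>a. cmod (add_corr A \<phi> a) powr (1/3))"
  define d i where "d = real (card D)" and "i = real (card I)"
  define S where "S = cmod (sum_over \<phi> I)"
  have bound: "cmod (\<phi> x) \<le> M" if "x \<in> {0..<int m}" for x
    unfolding M_def norm_sup_def carrier using that by (intro Max_ge) auto
  have "0 \<le> M" using order_trans[OF norm_ge_zero bound[of 0]] \<open>m > 0\<close> by simp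
  have "0 \<le> N" by (simp add: N_def norm_two_def sum_nonneg)
  have "0 \<le> c" unfolding c_def by (rule max_outside_nonneg) (auto simp: carrier)
  have "0 \<le> d" "0 \<le> i" "0 \<le> S" by (simp_all add: d_def i_def S_def)
  \<comment> \<open>The maximum \<open>c\<close> is taken over cube roots, so the correlations
    themselves are bounded by its cube.\<close>
  have outside: "cmod (add_corr A \<phi> x) \<le> c ^ 3" if "x \<in> {0..<int m} - D" for x
  proof -
    have "cmod (add_corr A \<phi> x) powr (1/3) \<le> c"
      unfolding c_def using that by (intro max_outside_ge) (auto simp: carrier)
    then have "(cmod (add_corr A \<phi> x) powr (1/3)) ^ 3 \<le> c ^ 3" by (intro power_mono) auto
    then show ?thesis by (simp flip: powr_numeral add: powr_powr)
  qed
  have "finite D"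
    using \<open>D \<subseteq> carrier A\<close> finite_subset by (fastforce simp: carrier)
  \<comment> \<open>Injectivity transfers the size and the sum of \<open>I\<close> to the integer
    interval, which has genuine endpoints to slide.\<close>
  have card: "card I = card {a..b}" unfolding I by (rule card_image[OF inj])
  have S_eq: "S = cmod (\<Sum>h\<in>{a..b}. \<phi> (h mod int m))"
    unfolding S_def sum_over_def I by (simp add: sum.reindex[OF inj] o_def)
  have "S ^ 3 \<le> 6 * M * (\<Sum>x\<in>{0..<int m}. (cmod (\<Sum>h\<in>{a..b}. \<phi> ((x + h) mod int m)))\<^sup>2)"
    unfolding S_eq using \<open>m > 0\<close> inj bound by (rule cube_sum_interval_le)
  also have "\<dots> \<le> 6 * M * (d * i * N\<^sup>2 + i\<^sup>2 * c ^ 3)"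
    unfolding d_def i_def N_def card A_def
    by (intro mult_left_mono sum_translates_square_le \<open>m > 0\<close> inj)
      (use \<open>0 \<le> M\<close> \<open>0 \<le> c\<close> \<open>finite D\<close> outside in \<open>auto simp: A_def\<close>)
  \<comment> \<open>The perfect cube 8 yields the leading factor 2 of the claim.\<close>
  also have "\<dots> \<le> 8 * M * (d * i * N\<^sup>2 + i\<^sup>2 * c ^ 3)"
    using \<open>0 \<le> M\<close> \<open>0 \<le> d\<close> \<open>0 \<le> i\<close> \<open>0 \<le> c\<close> by (intro mult_right_mono) auto
  finally have "(S ^ 3) powr (1/3) \<le> (8 * M * (d * i * N\<^sup>2 + i\<^sup>2 * c ^ 3)) powr (1/3)"
    using \<open>0 \<le> S\<close> by (intro powr_mono2) auto
  moreover have "(S ^ 3) powr (1/3) = S" "(c ^ 3) powr (1/3) = c"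
    using \<open>0 \<le> S\<close> \<open>0 \<le> c\<close> by (simp_all flip: powr_numeral add: powr_powr)
  moreover have "(N\<^sup>2) powr (1/3) = N powr (2/3)" "(i\<^sup>2) powr (1/3) = i powr (2/3)"
    using \<open>0 \<le> N\<close> \<open>0 \<le> i\<close> by (simp_all flip: powr_numeral add: powr_powr)
  moreover have "(8::real) powr (1/3) = 2"
    using powr_powr[of 2 3 "1/3::real"] by simp
  ultimately have "S \<le> 2 * M powr (1/3) * (d * i * N\<^sup>2 + i\<^sup>2 * c ^ 3) powr (1/3)"
    using \<open>0 \<le> M\<close> \<open>0 \<le> d\<close> \<open>0 \<le> i\<close> \<open>0 \<le> c\<close> by (simp add: powr_mult)
  \<comment> \<open>Subadditivity separates the contributions of the differences inside and outside
    \<open>D\<close>.\<close>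
  also have "(d * i * N\<^sup>2 + i\<^sup>2 * c ^ 3) powr (1/3) \<le> (d * i * N\<^sup>2) powr (1/3) + (i\<^sup>2 * c ^ 3) powr (1/3)"
    using \<open>0 \<le> d\<close> \<open>0 \<le> i\<close> \<open>0 \<le> c\<close> by (intro powr_one_third_add_le) auto
  also have "\<dots> = d powr (1/3) * i powr (1/3) * N powr (2/3) + i powr (2/3) * c"
    using \<open>0 \<le> d\<close> \<open>0 \<le> i\<close> \<open>0 \<le> c\<close> \<open>(c ^ 3) powr (1/3) = c\<close>
      \<open>(N\<^sup>2) powr (1/3) = N powr (2/3)\<close> \<open>(i\<^sup>2) powr (1/3) = i powr (2/3)\<close>
    by (simp add: powr_mult)
  also have "\<dots> \<le> d powr (1/3) * i powr (1/3) * N powr (2/3) + i powr (2/3) * c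
      + 2/3 * i powr (2/3) * M powr (2/3)"
    by simp
  finally show ?thesis
    by (simp add: S_def M_def N_def d_def i_def c_def mult_left_mono)
qed

end
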